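(* Consider the stochastic unbounded min-knapsack problem described in the context, and assume every type $i$ is expensive, i.e. $c_i\ge\theta T$. Then the output $\hat V$ of Algorithm DP described in the context satisfies \[(1-\delta)\Big(1-\frac{\epsilon}{10}\Big)\hat V\le OPT_W\le \hat V.\]
   Context: Fix integers $n\ge1$, $W\ge1$ and $\epsilon\in(0,1)$. There are $n$ item types; type $i$ has a deterministic cost $c_i>0$ and a random weight $X_i$ with known distribution supported in $\{1,\dots,W\}$ (standing assumption: positive integer weights). Infinitely many items of each type, weights mutually independent; items are inserted one at a time, each weight revealed upon insertion, until the total weight is at least $W$; a strategy chooses adaptively which type to insert. Let $d_i(k)=\Pr[X_i=k]$. Set $OPT_w=0$ for integers $w\le0$ and $OPT_w=\min_{1\le j\le n}\big(c_j+\sum_{k=1}^{W}d_j(k)OPT_{w-k}\big)$ for $1\le w\le W$; $OPT_W$ is the minimum expected total cost. Let $\bar E[X_i]=\sum_{j=1}^W d_i(j)2^{\lfloor\log_2 j\rfloor}$, $T=\frac W2\min_i\frac{c_i}{\bar E[X_i]}$, $\theta=\frac{\epsilon}{10n}$, $\delta=\frac{\epsilon^2}{100n}$. Algorithm DP: set $f_0=0$. For $i=1,2,\dots,\lceil1/\delta\rceil+1$: given $f_0,\dots,f_{i-1}$, define for integers $w\ge1$: $g_w=j\delta T$ if $f_{j-1}<w\le f_j$ for some $1\le j\le i-1$, and $g_w=i\delta T$ if $w>f_{i-1}$; let $f_i=\max\{w'\in\{0,\dots,W\}:\exists k,\ c_k+\sum_{j=1}^{w'-1}d_k(w'-j)g_j\le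 i\delta T\}$ (with $f_i=0$ if no such $w'$ exists). If $f_i\ge W$, the algorithm outputs $\hat V=i\delta T$ and stops.
   Formalization: The bounds are stated for instances in which Algorithm DP produces an output; with the stated T and loop bound it may end without one (e.g. n=W=1, c_1=1, X_1=1), and then V-hat is undefined. *)

theory Defs
  imports "HOL-Probability.Probability_Mass_Function"
begin

text \<open>
  Item types are the indices \<open>1, \<dots>, n\<close>. Type \<open>i\<close> has cost \<open>c i\<close> and weight distribution
  \<open>X i\<close>, so \<open>d\<^sub>i(k)\<close> is \<open>pmf (X i) k\<close>.
\<close>

text \<open>Truncated subtraction on naturals renders the convention that the optimum is 0 for every
  remaining weight \<open>w \<le> 0\<close>.\<close>

function OPT :: "nat \<Rightarrow> nat \<Rightarrow> (nat \<Rightarrow> real) \<Rightarrow> (nat \<Rightarrow> nat pmf) \<Rightarrow> nat \<Rightarrow> real" where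
  "OPT n W c X w =
     (if w = 0 then 0
      else Min ((\<lambda>j. c j + (\<Sum>k\<in>{1..W}. pmf (X j) k * OPT n W c X (w - k))) ` {1..n}))"
  by pat_completeness auto
termination
  by (relation "Wellfounded.measure (\<lambda>(n, W, c, X, w). w)") auto

declare OPT.simps [simp del]

definition Ebar :: "nat \<Rightarrow> nat pmf \<Rightarrow> real" where
  "Ebar W D = (\<Sum>j\<in>{1..W}. pmf D j * 2 powi \<lfloor>log 2 (real j)\<rfloor>)"

definition T_est :: "nat \<Rightarrow> nat \<Rightarrow> (nat \<Rightarrow> real) \<Rightarrow> (nat \<Rightarrow> nat pmf) \<Rightarrow> real" where
  "T_est n W c X = real W / 2 * Min ((\<lambda>i. c i / Ebar W (X i)) ` {1..n})"

definition theta :: "nat \<Rightarrow> real \<Rightarrow> real" where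
  "theta n \<epsilon> = \<epsilon> / (10 * real n)"

definition delta :: "nat \<Rightarrow> real \<Rightarrow> real" where
  "delta n \<epsilon> = \<epsilon>\<^sup>2 / (100 * real n)"

text \<open>
  \<open>dp_g s f i w\<close> is the value \<open>g\<^sub>w\<close> in iteration \<open>i\<close>, with grid spacing \<open>s = \<delta>T\<close>; it only reads
  \<open>f 0, \<dots>, f (i - 1)\<close>. When \<open>1 \<le> w \<le> f (i - 1)\<close> and \<open>f 0 = 0\<close>, an index \<open>j\<close> as below exists; it is
  unique because the thresholds computed by the algorithm are nondecreasing.
\<close>

definition dp_g :: "real \<Rightarrow> (nat \<Rightarrow> nat) \<Rightarrow> nat \<Rightarrow> nat \<Rightarrow> real" where
  "dp_g s f i w =
     (if f (i - 1) < w then real i * s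
      else real (LEAST j. 1 \<le> j \<and> j \<le> i - 1 \<and> f (j - 1) < w \<and> w \<le> f j) * s)"

definition dp_feasible ::
  "nat \<Rightarrow> nat \<Rightarrow> (nat \<Rightarrow> real) \<Rightarrow> (nat \<Rightarrow> nat pmf) \<Rightarrow> real \<Rightarrow> (nat \<Rightarrow> nat) \<Rightarrow> nat \<Rightarrow> nat set" where
  "dp_feasible n W c X s f i =
     {w'\<in>{0..W}. \<exists>k\<in>{1..n}.
        c k + (\<Sum>j\<in>{1..w' - 1}. pmf (X k) (w' - j) * dp_g s f i j) \<le> real i * s}"

definition dp_next ::
  "nat \<Rightarrow> nat \<Rightarrow> (nat \<Rightarrow> real) \<Rightarrow> (nat \<Rightarrow> nat pmf) \<Rightarrow> real \<Rightarrow> (nat \<Rightarrow> nat) \<Rightarrow> nat \<Rightarrow> nat" where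
  "dp_next n W c X s f i =
     (if dp_feasible n W c X s f i = {} then 0 else Max (dp_feasible n W c X s f i))"

text \<open>The guard \<open>j < i\<close> only serves termination, as \<open>dp_next\<close> never reads \<open>f j\<close> for \<open>j \<ge> i\<close>.\<close>

function dp_f :: "nat \<Rightarrow> nat \<Rightarrow> (nat \<Rightarrow> real) \<Rightarrow> (nat \<Rightarrow> nat pmf) \<Rightarrow> real \<Rightarrow> nat \<Rightarrow> nat" where
  "dp_f n W c X s i =
     (if i = 0 then 0
      else dp_next n W c X s (\<lambda>j. if j < i then dp_f n W c X s j else 0) i)"
  by pat_completeness auto
termination
  by (relation "Wellfounded.measure (\<lambda>(n, W, c, X, s, i). i)") auto

declare dp_f.simps [simp del]

text \<open>
  The loop may be exhausted without reaching \<open>W\<close>, in which case nothing is output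
  (\<open>None\<close>). For instance, this happens for \<open>n = W = 1\<close>, \<open>c 1 = 1\<close> and weight constantly 1:
  then \<open>T = 1/2\<close>, and the last grid value is at most \<open>1/2 + \<delta> < 1 = c 1\<close>.
\<close>

definition dp_output ::
  "nat \<Rightarrow> nat \<Rightarrow> (nat \<Rightarrow> real) \<Rightarrow> (nat \<Rightarrow> nat pmf) \<Rightarrow> real \<Rightarrow> real option" where
  "dp_output n W c X \<epsilon> =
     (let s = delta n \<epsilon> * T_est n W c X;
          stops = (\<lambda>i. 1 \<le> i \<and> i \<le> nat \<lceil>1 / delta n \<epsilon>\<rceil> + 1 \<and> W \<le> dp_f n W c X s i)
      in if \<exists>i. stops i then Some (real (LEAST i. stops i) * s) else None)"

end

theory Submission
  imports Defs
begin

text \<open>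
  Put \<open>s = \<delta>T\<close> and let \<open>h w\<close> be \<open>s\<close> times the least \<open>j\<close> with \<open>w \<le> f j\<close>. In round \<open>i\<close> the algorithm
  uses \<open>g w = min (i s) (h w)\<close>, so \<open>h\<close> solves the recursion for the optimum with every value
  rounded up to the grid. Rounding up gives \<open>OPT w \<le> h w\<close>. Conversely, if \<open>h w = i s\<close>, then \<open>w\<close> was
  infeasible in round \<open>i - 1\<close>, so \<open>h w - s < c k + (\<Sum>l. d k l * h (w - l))\<close> for every type \<open>k\<close>.
  Each rounding thus loses at most \<open>s\<close>, and \<open>s \<le> (\<epsilon>/10) c k\<close> because all types are expensive, so
  the loss is paid by the fraction \<open>\<epsilon>/10\<close> of the cost of the inserted item. By induction on \<open>w\<close>,
  \<open>(1 - \<epsilon>/10) h w \<le> OPT w\<close>.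
\<close>

section \<open>Convolution sums and a closed form for the values \<open>dp_g\<close>\<close>

lemma sum_convolution_reindex:
  fixes p F :: "nat \<Rightarrow> real"
  assumes "w \<le> W" "F 0 = 0"
  shows "(\<Sum>l\<in>{1..W}. p l * F (w - l)) = (\<Sum>j\<in>{1..w - 1}. p (w - j) * F j)"
proof -
  have "(\<Sum>l\<in>{1..W}. p l * F (w - l)) = (\<Sum>l\<in>{1..w - 1}. p l * F (w - l))"
    \<comment> \<open>For \<open>l \<ge> w\<close> truncated subtraction gives
      \<open>w - l = 0\<close>, where \<open>F\<close> vanishes.\<close>
    by (rule sum.mono_neutral_right) (use assms in auto)
  also have "\<dots> = (\<Sum>j\<in>{1..w - 1}. p (w - j) * F j)"
    by (rule sum.reindex_bij_witness[where i = "\<lambda>j. w - j" and j = "\<lambda>j. w - j"]) auto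
  finally show ?thesis .
qed

text \<open>The disjunct \<open>i \<le> j\<close> caps the level at \<open>i\<close>: the minimum
  exists even if \<open>f\<close> never reaches \<open>w\<close>, and it depends only on
  \<open>f j\<close> for \<open>j < i\<close>, the data available in round \<open>i\<close>.\<close>

definition capped_level :: "(nat \<Rightarrow> nat) \<Rightarrow> nat \<Rightarrow> nat \<Rightarrow> nat" where
  "capped_level f i w = (LEAST j. i \<le> j \<or> w \<le> f j)"

lemma capped_level_reaches: "i \<le> capped_level f i w \<or> w \<le> f (capped_level f i w)"
  unfolding capped_level_def by (rule LeastI[of _ i]) simp

lemma capped_level_leI: "i \<le> j \<or> w \<le> f j \<Longrightarrow> capped_level f i w \<le> j"
  unfolding capped_level_def by (rule Least_le)

lemma capped_level_le: "capped_level f i w \<le> i"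
  by (rule capped_level_leI) simp

lemma less_capped_levelD: "j < capped_level f i w \<Longrightarrow> f j < w"
  using capped_level_leI[of i j w f] by (meson leD not_le)

lemma capped_level_mono: "w \<le> w' \<Longrightarrow> capped_level f i w \<le> capped_level f i w'"
  by (rule capped_level_leI) (use capped_level_reaches[of i f w'] in auto)

lemma capped_level_zero: "capped_level f i 0 = 0"
  using capped_level_leI[of i 0 0 f] by simp

lemma le_at_capped_level: "w \<le> f i \<Longrightarrow> w \<le> f (capped_level f i w)"
  using capped_level_reaches[of i f w] capped_level_le[of f i w] by auto

text \<open>Serves to replace the guarded function in the recursion of \<open>dp_f\<close> by
  \<open>dp_f\<close> itself.\<close>

lemma dp_g_cong:
  assumes "\<And>j. j < i \<Longrightarrow> f j = f' j" "i \<ge> 1"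
  shows "dp_g s f i w = dp_g s f' i w"
proof -
  have "(1 \<le> j \<and> j \<le> i - 1 \<and> f (j - 1) < w \<and> w \<le> f j) \<longleftrightarrow>
        (1 \<le> j \<and> j \<le> i - 1 \<and> f' (j - 1) < w \<and> w \<le> f' j)" for j
    using assms by (cases "1 \<le> j \<and> j \<le> i - 1") (auto simp: assms(1)[of j] assms(1)[of "j - 1"])
  moreover have "f (i - 1) = f' (i - 1)" using assms by simp
  ultimately show ?thesis unfolding dp_g_def by simp
qed

text \<open>If \<open>f (i - 1) < w\<close>, monotonicity keeps all earlier thresholds below
  \<open>w\<close>, so the cap is active; otherwise the first threshold reaching \<open>w\<close> is
  the index sought by \<open>dp_g\<close>.\<close>

lemma dp_g_eq_capped_level:
  assumes mono: "\<And>j. j < i \<Longrightarrow> f j \<le> f (i - 1)"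
    and "f 0 = 0" "1 \<le> i" "1 \<le> w"
  shows "dp_g s f i w = real (capped_level f i w) * s"
proof (cases "f (i - 1) < w")
  case True
  have "\<not> capped_level f i w < i"
    using mono[of "capped_level f i w"] capped_level_reaches[of i f w] True by linarith
  then have "capped_level f i w = i" using capped_level_le[of f i w] by linarith
  then show ?thesis using True by (simp add: dp_g_def)
next
  case False
  let ?m = "capped_level f i w"
  have le: "?m \<le> i - 1" by (rule capped_level_leI) (use False in auto)
  have reach: "w \<le> f ?m" using capped_level_reaches[of i f w] le \<open>1 \<le> i\<close> by auto
  have "1 \<le> ?m" using reach \<open>f 0 = 0\<close> \<open>1 \<le> w\<close> by (cases "?m = 0") auto
  then have below: "f (?m - 1) < w" by (intro less_capped_levelD[of _ f i]) auto
  have "(LEAST j. 1 \<le> j \<and> j \<le> i - 1 \<and> f (j - 1) < w \<and> w \<le> f j) = ?m"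
    by (rule Least_equality) (use le reach \<open>1 \<le> ?m\<close> below in \<open>auto intro: capped_level_leI\<close>)
  then show ?thesis using False by (simp add: dp_g_def)
qed

section \<open>The recursion for the optimum, with an arbitrary grid spacing
  \<open>s\<close>\<close>

locale min_knapsack =
  fixes n W :: nat and c :: "nat \<Rightarrow> real" and X :: "nat \<Rightarrow> nat pmf" and s :: real
  assumes n_pos: "1 \<le> n"
    and cost_pos: "\<And>k. k \<in> {1..n} \<Longrightarrow> 0 < c k"
    and s_nonneg: "0 \<le> s"
begin

abbreviation opt :: "nat \<Rightarrow> real" where "opt \<equiv> OPT n W c X"

abbreviation f :: "nat \<Rightarrow> nat" where "f \<equiv> dp_f n W c X s"

definition g :: "nat \<Rightarrow> nat \<Rightarrow> real" where "g i w = real (capped_level f i w) * s"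

definition choice_value :: "(nat \<Rightarrow> real) \<Rightarrow> nat \<Rightarrow> nat \<Rightarrow> real" where
  "choice_value F k w = c k + (\<Sum>l\<in>{1..W}. pmf (X k) l * F (w - l))"

lemma choice_value_mono:
  assumes "\<And>l. 1 \<le> l \<Longrightarrow> l \<le> W \<Longrightarrow> F (w - l) \<le> F' (w' - l)"
  shows "choice_value F k w \<le> choice_value F' k w'"
  unfolding choice_value_def using assms by (intro add_left_mono sum_mono mult_left_mono) auto

lemma opt_0: "opt 0 = 0"
  by (simp add: OPT.simps)

lemma opt_eq:
  assumes "w \<noteq> 0"
  shows "opt w = Min ((\<lambda>k. choice_value opt k w) ` {1..n})"
  using assms by (subst OPT.simps) (simp add: choice_value_def)

lemma opt_le_choice: "w \<noteq> 0 \<Longrightarrow> k \<in> {1..n} \<Longrightarrow> opt w \<le> choice_value opt k w"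
  by (subst opt_eq) auto

lemma opt_attained:
  assumes "w \<noteq> 0"
  obtains k where "k \<in> {1..n}" "opt w = choice_value opt k w"
proof -
  have "opt w \<in> (\<lambda>k. choice_value opt k w) ` {1..n}"
    unfolding opt_eq[OF assms] using n_pos by (intro Min_in) auto
  then show thesis using that by blast
qed

lemma g_zero: "g i 0 = 0"
  by (simp add: g_def capped_level_zero)

lemma g_mono: "w \<le> w' \<Longrightarrow> g i w \<le> g i w'"
  unfolding g_def using s_nonneg by (intro mult_right_mono) (auto intro: capped_level_mono)

section \<open>Thresholds: characterization by feasibility, and monotonicity\<close>

lemma f_0: "f 0 = 0"
  by (simp add: dp_f.simps)

lemma f_le_W: "f i \<le> W"
proof -
  have "dp_feasible n W c X s h i \<subseteq> {0..W}" for h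
    by (auto simp: dp_feasible_def)
  then have "dp_next n W c X s h i \<le> W" for h
    using Max_in[of "dp_feasible n W c X s h i"] finite_subset[of _ "{0..W}"]
    unfolding dp_next_def by fastforce
  then show ?thesis by (subst dp_f.simps) simp
qed

lemma dp_feasible_eq:
  assumes "1 \<le> i" and mono: "\<And>j. j < i \<Longrightarrow> f j \<le> f (i - 1)"
  shows "dp_feasible n W c X s (\<lambda>j. if j < i then f j else 0) i =
    {w\<in>{0..W}. \<exists>k\<in>{1..n}. choice_value (g i) k w \<le> real i * s}"
proof -
  have "dp_g s (\<lambda>j. if j < i then f j else 0) i w = g i w" if "1 \<le> w" for w
    using dp_g_cong[of i "\<lambda>j. if j < i then f j else 0" f] dp_g_eq_capped_level[OF mono f_0] that assms(1)
    by (simp add: g_def)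
  then have "(\<Sum>j\<in>{1..w - 1}. pmf (X k) (w - j) * dp_g s (\<lambda>j. if j < i then f j else 0) i j) =
      (\<Sum>l\<in>{1..W}. pmf (X k) l * g i (w - l))" if "w \<le> W" for w k
    using sum_convolution_reindex[OF that, of "g i" "pmf (X k)"] by (simp add: g_zero)
  then show ?thesis
    unfolding dp_feasible_def choice_value_def by (intro Collect_cong conj_cong) auto
qed

text \<open>Monotonicity is assumed only before round \<open>i\<close>, so that these facts are
  available inside the induction that proves it.\<close>

lemma f_cases_if_mono_below:
  assumes "1 \<le> i" "\<And>j. j < i \<Longrightarrow> f j \<le> f (i - 1)"
  shows "f i = 0 \<or> (\<exists>k\<in>{1..n}. choice_value (g i) k (f i) \<le> real i * s)"
    and "\<lbrakk>w \<le> W; k \<in> {1..n}; choice_value (g i) k w \<le> real i * s\<rbrakk> \<Longrightarrow> w \<le> f i"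
proof -
  let ?S = "{w\<in>{0..W}. \<exists>k\<in>{1..n}. choice_value (g i) k w \<le> real i * s}"
  have feasible: "dp_feasible n W c X s (\<lambda>j. if j < i then f j else 0) i = ?S"
    by (rule dp_feasible_eq) (use assms in auto)
  have "f i = dp_next n W c X s (\<lambda>j. if j < i then f j else 0) i"
    using assms(1) by (subst dp_f.simps) simp
  then have f: "f i = (if ?S = {} then 0 else Max ?S)"
    unfolding dp_next_def feasible .
  have fin: "finite ?S" by simp
  show "f i = 0 \<or> (\<exists>k\<in>{1..n}. choice_value (g i) k (f i) \<le> real i * s)"
    using Max_in[OF fin] f by (cases "?S = {}") auto
  assume "w \<le> W" "k \<in> {1..n}" "choice_value (g i) k w \<le> real i * s"
  then have "w \<in> ?S" by auto
  then show "w \<le> f i" using Max_ge[OF fin] f by auto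
qed

text \<open>The item that makes \<open>f i\<close> feasible in round \<open>i\<close> does so again
  in the next round: raising the cap does not raise the level of weights up to \<open>f i\<close>,
  while the budget grows by \<open>s\<close>.\<close>

lemma f_le_Suc: "f i \<le> f (Suc i)"
proof (induction i rule: less_induct)
  case (less i)
  have mono: "f j \<le> f m" if "j \<le> m" "m \<le> i" for j m
    using that(1) that(2)
    by (induction rule: dec_induct) (use less.IH in \<open>auto intro: order_trans\<close>)
  show ?case
  proof (cases "f i = 0")
    case False
    then have "1 \<le> i" using f_0 by (cases i) auto
    obtain k where k: "k \<in> {1..n}" "choice_value (g i) k (f i) \<le> real i * s"
      using f_cases_if_mono_below(1)[of i] \<open>1 \<le> i\<close> mono False by auto
    have "g (Suc i) (f i - l) \<le> g i (f i - l)" for l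
      unfolding g_def using s_nonneg le_at_capped_level[of "f i - l" f i]
      by (intro mult_right_mono) (auto intro: capped_level_leI)
    then have "choice_value (g (Suc i)) k (f i) \<le> real (Suc i) * s"
      using k(2) s_nonneg choice_value_mono[of "g (Suc i)" "f i" "g i" "f i" k]
      by (force simp: algebra_simps)
    then show ?thesis
      using f_cases_if_mono_below(2)[of "Suc i" "f i" k] f_le_W k(1) mono by simp
  qed simp
qed

lemma f_mono: "j \<le> i \<Longrightarrow> f j \<le> f i"
  using f_le_Suc by (rule lift_Suc_mono_le)

lemma f_attained:
  assumes "0 < f i"
  obtains k where "k \<in> {1..n}" "choice_value (g i) k (f i) \<le> real i * s"
proof -
  have "1 \<le> i" using assms f_0 by (cases i) auto
  then show thesis using f_cases_if_mono_below(1)[of i] assms f_mono that by auto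
qed

text \<open>Index 0 is no round of the algorithm, but the bound holds there because the cap 0 makes
  \<open>g 0\<close> vanish and costs are positive. The first grid step is thus covered too.\<close>

lemma above_f_infeasible:
  assumes "f i < w" "w \<le> W" "k \<in> {1..n}"
  shows "real i * s < choice_value (g i) k w"
proof (cases "i = 0")
  case True
  have "g 0 v = 0" for v using capped_level_le[of f 0 v] by (simp add: g_def)
  then show ?thesis using True cost_pos[OF assms(3)] by (simp add: choice_value_def)
next
  case False
  then show ?thesis using f_cases_if_mono_below(2)[of i w k] assms f_mono by fastforce
qed

section \<open>The upper and lower bounds for the optimum\<close>

lemma opt_le_level: "w \<le> f i \<Longrightarrow> opt w \<le> real i * s"
proof (induction w arbitrary: i rule: less_induct)
  case (less w)
  show ?case
  proof (cases "w = 0")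
    case True
    then show ?thesis using s_nonneg by (simp add: opt_0)
  next
    case False
    then obtain k where k: "k \<in> {1..n}" "choice_value (g i) k (f i) \<le> real i * s"
      using f_attained[of i] less.prems by auto
    \<comment> \<open>The item feasible at the threshold \<open>f i\<close> is also used at
      \<open>w\<close>: the remaining weight \<open>w - l\<close> is at most \<open>f i\<close>,
      hence is reached at its own capped level.\<close>
    have "opt (w - l) \<le> g i (f i - l)" if "1 \<le> l" for l
    proof -
      have "w - l \<le> f i" using less.prems by simp
      then have "opt (w - l) \<le> g i (w - l)"
        unfolding g_def using False that by (intro less.IH le_at_capped_level[of _ f i]) auto
      also have "\<dots> \<le> g i (f i - l)" by (intro g_mono diff_le_mono less.prems)
      finally show ?thesis .
    qed
    then have "choice_value opt k w \<le> choice_value (g i) k (f i)"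
      by (intro choice_value_mono) auto
    then show ?thesis using opt_le_choice[OF False k(1)] k(2) by linarith
  qed
qed

text \<open>The premise on \<open>m < j\<close> makes \<open>j\<close> a lower bound for any level
  reaching \<open>w\<close>, without requiring that one exists. Capped levels satisfy it, so the
  induction hypothesis applies to every \<open>g i (w - l)\<close>.\<close>

lemma level_le_opt:
  fixes e :: real
  assumes "0 \<le> e" "e \<le> 1" and expensive: "\<And>k. k \<in> {1..n} \<Longrightarrow> s \<le> e * c k"
  shows "\<lbrakk>w \<le> W; \<And>m. m < j \<Longrightarrow> f m < w\<rbrakk> \<Longrightarrow> (1 - e) * (real j * s) \<le> opt w"
proof (induction w arbitrary: j rule: less_induct)
  case (less w)
  show ?case
  proof (cases "w = 0")
    case True
    then show ?thesis using less.prems(2)[of 0] by (cases "j = 0") (auto simp: opt_0)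
  next
    case False
    then obtain k where k: "k \<in> {1..n}" "opt w = choice_value opt k w"
      using opt_attained by blast
    have IH: "(1 - e) * g i (w - l) \<le> opt (w - l)" if "1 \<le> l" for i l
      unfolding g_def using False that less.prems(1)
      by (intro less.IH) (auto dest: less_capped_levelD)
    \<comment> \<open>Only the continuation values are scaled by \<open>1 - e\<close>; the item is
      paid in full, which leaves \<open>e * c k\<close> to absorb one rounding.\<close>
    have "(1 - e) * (choice_value (g i) k w - c k) \<le> choice_value opt k w - c k" for i
      unfolding choice_value_def using IH
      by (auto simp: sum_distrib_left mult.left_commute[of "1 - e"] intro!: sum_mono mult_left_mono)
    then have bound: "(1 - e) * choice_value (g i) k w + e * c k \<le> opt w" for i
      using k(2) by (simp add: algebra_simps)
    show ?thesis
    proof (cases j)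
      case 0
      have "0 \<le> choice_value (g 0) k w"
        unfolding choice_value_def g_def using cost_pos[OF k(1)] s_nonneg
        by (intro add_nonneg_nonneg sum_nonneg) auto
      then have "0 \<le> (1 - e) * choice_value (g 0) k w" using assms(2) by simp
      moreover have "0 \<le> e * c k" using assms(1) cost_pos[OF k(1)] by simp
      ultimately show ?thesis using 0 bound[of 0] by simp
    next
      case (Suc i)
      have "real i * s \<le> choice_value (g i) k w"
        using above_f_infeasible[of i w k] less.prems Suc k(1) by simp
      then have "(1 - e) * (real i * s) \<le> (1 - e) * choice_value (g i) k w"
        using assms(2) by (intro mult_left_mono) auto
      moreover have "(1 - e) * s \<le> s" using assms(1) s_nonneg by (simp add: algebra_simps)
      ultimately show ?thesis
        using Suc bound[of i] expensive[OF k(1)] by (simp add: algebra_simps)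
    qed
  qed
qed

end

section \<open>Instantiation with the grid of the algorithm\<close>

lemma T_est_nonneg:
  assumes "1 \<le> n" "\<And>i. i \<in> {1..n} \<Longrightarrow> 0 < c i"
  shows "0 \<le> T_est n W c X"
proof -
  have "0 \<le> c i / Ebar W (X i)" if "i \<in> {1..n}" for i
    using assms(2)[OF that] unfolding Ebar_def by (intro divide_nonneg_nonneg sum_nonneg) auto
  then have "0 \<le> Min ((\<lambda>i. c i / Ebar W (X i)) ` {1..n})"
    using assms(1) by (intro Min.boundedI) auto
  then show ?thesis unfolding T_est_def by simp
qed

theorem theorem1:
  fixes n W :: nat
    and \<epsilon> V :: real
    and c :: "nat \<Rightarrow> real"
    and X :: "nat \<Rightarrow> nat pmf"
  assumes "n \<ge> 1"
    and "W \<ge> 1"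
    and "0 < \<epsilon>"
    and "\<epsilon> < 1"
    and "\<And>i. i \<in> {1..n} \<Longrightarrow> c i > 0"
    and "\<And>i. i \<in> {1..n} \<Longrightarrow> set_pmf (X i) \<subseteq> {1..W}"
    and "\<And>i. i \<in> {1..n} \<Longrightarrow> c i \<ge> theta n \<epsilon> * T_est n W c X"
    and "dp_output n W c X \<epsilon> = Some V"
  shows "(1 - delta n \<epsilon>) * (1 - \<epsilon> / 10) * V \<le> OPT n W c X W \<and> OPT n W c X W \<le> V"
proof -
  define s where "s = delta n \<epsilon> * T_est n W c X"
  define stops where
    "stops = (\<lambda>i. 1 \<le> i \<and> i \<le> nat \<lceil>1 / delta n \<epsilon>\<rceil> + 1 \<and> W \<le> dp_f n W c X s i)"
  have "0 \<le> delta n \<epsilon>" by (simp add: delta_def)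
  then have "0 \<le> s" unfolding s_def using T_est_nonneg[of n c] assms(1,5) by simp
  interpret min_knapsack n W c X s
    by unfold_locales (use assms(1,5) \<open>0 \<le> s\<close> in auto)
  define i where "i = (LEAST i. stops i)"
  have out: "(if \<exists>i. stops i then Some (real i * s) else None) = Some V"
    using assms(8) unfolding dp_output_def Let_def s_def[symmetric] stops_def[symmetric] i_def[symmetric] .
  then have V: "V = real i * s" and "\<exists>i. stops i" by (auto split: if_splits)
  then have "stops i" unfolding i_def by (auto intro: LeastI)
  \<comment> \<open>Minimality of \<open>i\<close> covers only \<open>m \<ge> 1\<close>, as
    \<open>stops\<close> excludes 0; for \<open>m = 0\<close> the bound is
    \<open>W \<ge> 1\<close>.\<close>
  have "f m < W" if "m < i" for m
  proof (cases "m = 0")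
    case True
    then show ?thesis using f_0 assms(2) by simp
  next
    case False
    then show ?thesis
      using not_less_Least[of m stops] that \<open>stops i\<close> unfolding i_def[symmetric] by (auto simp: stops_def)
  qed
  moreover have "s \<le> \<epsilon> / 10 * c k" if "k \<in> {1..n}" for k
  proof -
    \<comment> \<open>The constants are matched: \<open>\<delta> = (\<epsilon>/10) \<theta>\<close>,
      so expensiveness yields the lower bound with \<open>e = \<epsilon>/10\<close>.\<close>
    have "s = \<epsilon> / 10 * (theta n \<epsilon> * T_est n W c X)"
      by (simp add: s_def delta_def theta_def power2_eq_square)
    then show ?thesis using assms(3) assms(7)[OF that] by (simp add: mult_left_mono)
  qed
  ultimately have lower: "(1 - \<epsilon> / 10) * V \<le> opt W"
    unfolding V using assms(3,4) by (intro level_le_opt) auto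
  have "0 \<le> (1 - \<epsilon> / 10) * V" using V \<open>0 \<le> s\<close> assms(4) by simp
  then have "(1 - delta n \<epsilon>) * ((1 - \<epsilon> / 10) * V) \<le> (1 - \<epsilon> / 10) * V"
    using \<open>0 \<le> delta n \<epsilon>\<close> by (simp add: mult_left_le_one_le left_diff_distrib)
  then have "(1 - delta n \<epsilon>) * (1 - \<epsilon> / 10) * V \<le> opt W"
    using lower by (simp add: mult.assoc)
  moreover have "opt W \<le> V"
    unfolding V using \<open>stops i\<close> by (intro opt_le_level) (simp add: stops_def)
  ultimately show ?thesis ..
qed

end
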